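(* Every oriented tree of order $n$ with $k$ leaves is $\left(\frac32 n+\frac32 k-2\right)$-unavoidable.
   Context: A tournament is an orientation of a complete graph. A digraph $D$ is $m$-unavoidable if every tournament of order $m$ (for non-integer $m$, every tournament with at least $m$ vertices suffices to be read as order $\lceil m\rceil$) contains $D$ as a subdigraph. An oriented tree is an orientation of a tree. A leaf of an oriented tree is a vertex adjacent to at most one vertex. *)

theory Defs
  imports Complex_Main "Graph_Theory.Graph_Theory"
begin

text \<open>
  As in the \<open>Graph_Theory\<close> library, an undirected simple graph is a finite symmetric
  loop-free digraph (\<^term>\<open>pair_graph\<close>), each edge being a pair of opposite arcs.
\<close>

definition orientation :: "'a pair_pre_digraph \<Rightarrow> 'a pair_pre_digraph \<Rightarrow> bool" where
  "orientation D G \<longleftrightarrow> pair_graph G \<and> mk_symmetric (with_proj D) = G \<and> asym (parcs D)"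

definition tournament :: "'a pair_pre_digraph \<Rightarrow> bool" where
  "tournament T \<longleftrightarrow> (\<exists>n G. complete_digraph n (with_proj G) \<and> orientation T G)"

text \<open>
  The library's \<^term>\<open>Digraph_Component.tree\<close> is not usable for undirected trees: it forbids
  \<^emph>\<open>directed\<close> cycles, and every edge of a symmetric digraph forms a directed cycle of length 2.
  The cycles of the undirected graph are the directed cycles of length at least 3,
  traversed in one of the two directions.
  Connected graphs are nonempty by the library's definition.
\<close>

definition undirected_tree :: "'a pair_pre_digraph \<Rightarrow> bool" where
  "undirected_tree G \<longleftrightarrow> pair_graph G \<and> Digraph_Component.connected (with_proj G) \<and>
     \<not> (\<exists>p. pre_digraph.cycle (with_proj G) p \<and> 3 \<le> length p)"

definition oriented_tree :: "'a pair_pre_digraph \<Rightarrow> bool" where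
  "oriented_tree D \<longleftrightarrow> (\<exists>G. undirected_tree G \<and> orientation D G)"

definition leaves :: "'a pair_pre_digraph \<Rightarrow> 'a set" where
  "leaves D = {v \<in> pverts D. card {u. (u, v) \<in> parcs D \<or> (v, u) \<in> parcs D} \<le> 1}"

text \<open>Containment as a (not necessarily induced) subdigraph, up to isomorphism.\<close>

definition contains_subdigraph :: "'b pair_pre_digraph \<Rightarrow> 'a pair_pre_digraph \<Rightarrow> bool" where
  "contains_subdigraph T D \<longleftrightarrow>
     (\<exists>H. subgraph H (with_proj T) \<and> digraph_iso (with_proj D) H)"

text \<open>
  The type argument is the type of the vertices of the tournaments; a theorem that leaves it
  a type variable covers tournaments on arbitrary vertices. A non-integral \<open>m\<close> is rounded up.
\<close>

definition unavoidable :: "'b itself \<Rightarrow> real \<Rightarrow> 'a pair_pre_digraph \<Rightarrow> bool" where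
  "unavoidable _ m D \<longleftrightarrow>
     (\<forall>T :: 'b pair_pre_digraph.
        tournament T \<and> int (card (pverts T)) = \<lceil>m\<rceil> \<longrightarrow> contains_subdigraph T D)"

end

theory Submission
  imports Defs
begin

text \<open>
  Order the tournament so that every vertex beats at least half of each interval that follows it
  (a local median order), and embed the tree by scanning this order: when the scan meets the
  image of a node, the block of nodes hanging from it goes to the first free out-neighbours.
  Pointing the tree away from a root, the blocks of a node are the components, with respect to
  the arcs towards the root, of its children along the other arcs; each component is an
  in-arborescence, embedded inside its slots by the same greedy scheme in the reversed
  tournament. The room used depends asymmetrically on the numbers of forward and of backward
  children, so it can be averaged over the tree and its reverse.
\<close>

subsection \<open>Local median orders\<close>

text \<open>The obstacle is an arc that points against the scan: a median order promises
  out-neighbours ahead, never in-neighbours. Nodes joined by such arcs are therefore placed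
  together, wholly among the out-neighbours of one host, and their inner arcs are settled afterwards
  by a fresh median order of the reversed tournament on just the chosen slots. Only half of what
  follows is promised to be out-neighbours, so a requested slot costs two positions. This doubles
  the inner room of a component. With \<open>fc\<close> and \<open>bc\<close> counting forward and
  backward children, \<open>s\<close> the sum of \<open>2 * fc - 1\<close> and \<open>t\<close> the
  sum of \<open>2 * bc - 1\<close> (each term cut off at 0), the room is
  \<open>1 + s + 2 * t\<close>; reversal turns it into \<open>1 + t + 2 * s\<close>. The two add up
  to \<open>2 + 3 * (s + t)\<close>, and \<open>s + t\<close> is at most \<open>n + l - 2\<close> if
  \<open>l\<close> of the \<open>n\<close> nodes are childless. Half of the total is thus at most
  3/2 n + 3/2 l - 2, and childless nodes are leaves.\<close>

fun forward_arcs :: "('b \<Rightarrow> 'b \<Rightarrow> bool) \<Rightarrow> 'b list \<Rightarrow> nat" where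
  "forward_arcs R [] = 0"
| "forward_arcs R (x # xs) = length (filter (R x) xs) + forward_arcs R xs"

lemma forward_arcs_insert:
  "forward_arcs R (bs @ x # cs)
    = forward_arcs R (bs @ cs) + length (filter (\<lambda>b. R b x) bs) + length (filter (R x) cs)"
  by (induction bs) auto

text \<open>Only the pairs of \<open>x\<close> with an entry of \<open>bs\<close> change their
  order. The balance is stated additively because subtraction on naturals truncates.\<close>

lemma forward_arcs_move:
  "forward_arcs R (as @ x # bs @ cs) + length (filter (\<lambda>b. R b x) bs)
    = forward_arcs R (as @ bs @ x # cs) + length (filter (R x) bs)"
  by (induction as) (auto simp: forward_arcs_insert)

text \<open>An order with the most forward arcs works: no entry gains by being moved behind an
  interval that follows it, so it has at least as many out-neighbours as in-neighbours there, and by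
  totality these cover the interval.\<close>

lemma local_median_order:
  fixes X :: "'b set"
  assumes "finite X" and total: "\<And>a b. a \<in> X \<Longrightarrow> b \<in> X \<Longrightarrow> a \<noteq> b \<Longrightarrow> R a b \<or> R b a"
  obtains xs where "distinct xs" "set xs = X"
    "\<And>i j. i < j \<Longrightarrow> j < length xs \<Longrightarrow> j - i \<le> 2 * card {h \<in> {i<..j}. R (xs ! i) (xs ! h)}"
proof -
  let ?P = "\<lambda>xs. distinct xs \<and> set xs = X"
  obtain xs0 where xs0: "?P xs0" using finite_distinct_list[OF \<open>finite X\<close>] by blast
  have bound: "\<exists>b. \<forall>ys. ?P ys \<longrightarrow> forward_arcs R ys < b"
  proof -
    have "finite {ys. ?P ys}"
      by (rule finite_subset[OF _ finite_lists_length_eq[OF \<open>finite X\<close>, of "card X"]])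
        (auto simp: distinct_card)
    then have "finite (forward_arcs R ` {ys. ?P ys})" by simp
    then show ?thesis unfolding finite_nat_set_iff_bounded by blast
  qed
  obtain xs where xs: "?P xs" and max: "\<And>ys. ?P ys \<Longrightarrow> forward_arcs R ys \<le> forward_arcs R xs"
    using ex_has_greatest_nat[of ?P xs0 "forward_arcs R"] xs0 bound
    by (metis less_imp_le)
  have "j - i \<le> 2 * card {h \<in> {i<..j}. R (xs ! i) (xs ! h)}" if ij: "i < j" "j < length xs" for i j
  proof -
    define x where "x = xs ! i"
    define bs where "bs = take (j - i) (drop (Suc i) xs)"
    define cs where "cs = drop (Suc j) xs"
    have split: "xs = take i xs @ x # bs @ cs"
    proof -
      have "bs @ cs = drop (Suc i) xs"
        using ij append_take_drop_id[of "j - i" "drop (Suc i) xs"]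
        by (simp add: bs_def cs_def)
      then show ?thesis using id_take_nth_drop[of i xs] ij by (simp add: x_def)
    qed
    have len: "length bs = j - i" using ij by (simp add: bs_def)
    have nth: "bs ! h = xs ! (Suc i + h)" if "h < j - i" for h
      using ij that by (simp add: bs_def)
    have "?P (take i xs @ bs @ x # cs)"
      using xs by (subst (asm) (1 2) split) auto
    then have "forward_arcs R (take i xs @ bs @ x # cs) \<le> forward_arcs R (take i xs @ x # bs @ cs)"
      using max split by metis
    then have le: "length (filter (\<lambda>b. R b x) bs) \<le> length (filter (R x) bs)"
      using forward_arcs_move[of R "take i xs" x bs cs] by linarith
    have sub: "x \<notin> set bs" "x \<in> X" "set bs \<subseteq> X"
      using xs by (subst (asm) (1 2) split, auto)+
    have "filter (\<lambda>b. \<not> R x b) bs = filter (\<lambda>b. \<not> R x b \<and> R b x) bs"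
      using sub total by (intro filter_cong) auto
    moreover have "length (filter (\<lambda>b. \<not> R x b \<and> R b x) bs) \<le> length (filter (\<lambda>b. R b x) bs)"
      by (induction bs) auto
    ultimately have "length bs \<le> 2 * length (filter (R x) bs)"
      using sum_length_filter_compl[of "R x" bs] le by simp
    moreover have "length (filter (R x) bs) = card {h \<in> {i<..j}. R (xs ! i) (xs ! h)}"
    proof -
      have "(\<lambda>h. Suc i + h) ` {h. h < length bs \<and> R x (bs ! h)} = {h \<in> {i<..j}. R (xs ! i) (xs ! h)}"
      proof (intro equalityI subsetI)
        fix h assume h: "h \<in> {h \<in> {i<..j}. R (xs ! i) (xs ! h)}"
        then show "h \<in> (\<lambda>h. Suc i + h) ` {h. h < length bs \<and> R x (bs ! h)}"
          by (intro image_eqI[of _ _ "h - Suc i"]) (auto simp: len nth x_def)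
      qed (auto simp: len nth x_def)
      moreover have "card ((\<lambda>h. Suc i + h) ` {h. h < length bs \<and> R x (bs ! h)})
          = card {h. h < length bs \<and> R x (bs ! h)}"
        by (rule card_image) (auto intro: inj_onI)
      ultimately show ?thesis by (simp add: length_filter_conv_card)
    qed
    ultimately show ?thesis by (simp add: len)
  qed
  then show ?thesis using xs that by blast
qed

subsection \<open>Greedy embedding along a local median order\<close>

text \<open>Closure under smaller elements of \<open>F\<close> lets a single chosen slot beyond a
  position certify that every free out-neighbour up to that position has been chosen as
  well.\<close>

lemma initial_subset_with_card:
  fixes F :: "nat set"
  assumes "finite F" "d \<le> card F"
  obtains S where "S \<subseteq> F" "card S = d" "\<And>a b. a \<in> S \<Longrightarrow> b \<in> F \<Longrightarrow> b < a \<Longrightarrow> b \<in> S"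
proof -
  have "\<exists>S\<subseteq>F. card S = d \<and> (\<forall>a\<in>S. \<forall>b\<in>F. b < a \<longrightarrow> b \<in> S)"
    using assms(2)
  proof (induction d)
    case 0
    show ?case by (rule exI[of _ "{}"]) simp
  next
    case (Suc d)
    then obtain S where S: "S \<subseteq> F" "card S = d" "\<forall>a\<in>S. \<forall>b\<in>F. b < a \<longrightarrow> b \<in> S" by auto
    have fin: "finite S" "finite (F - S)" using S assms(1) finite_subset by auto
    have ne: "F - S \<noteq> {}"
      using S Suc.prems fin card_mono[of S F] by auto
    define c where "c = Min (F - S)"
    have c: "c \<in> F - S" "\<And>b. b \<in> F - S \<Longrightarrow> c \<le> b"
      using Min_in[OF fin(2) ne] Min_le[OF fin(2)] by (auto simp: c_def)
    show ?case
    proof (intro exI[of _ "insert c S"] conjI ballI impI)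
      fix a b assume "a \<in> insert c S" "b \<in> F" "b < a"
      then show "b \<in> insert c S" using S(3) c(2)[of b] by auto
    qed (use S c fin in auto)
  qed
  then show ?thesis using that by blast
qed

text \<open>\<open>V0\<close> is the root block, \<open>B x\<close> the block hosted by
  \<open>x\<close>, and \<open>A\<close> holds the arcs inside blocks. A block has to fit into every
  slot set of size \<open>d x\<close>, since the scan alone decides which slots these are;
  \<open>d x\<close> may exceed the size of the block, so chosen slots can stay empty. Truncated
  subtraction makes a node with \<open>d x = 0\<close> free of charge.\<close>

lemma greedy_block_embedding:
  fixes V V0 :: "nat set" and host d :: "nat \<Rightarrow> nat" and A :: "nat \<Rightarrow> nat \<Rightarrow> bool"
    and R :: "nat \<Rightarrow> nat \<Rightarrow> bool"
  defines "B \<equiv> \<lambda>x. {z \<in> V - V0. host z = x}"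
  assumes finV: "finite V" and V0: "V0 \<subseteq> V" "V0 \<noteq> {}"
    and host: "\<And>z. z \<in> V - V0 \<Longrightarrow> host z \<in> V \<and> host z < z"
    and median: "\<And>i j. i < j \<Longrightarrow> j < m \<Longrightarrow> j - i \<le> 2 * card {h \<in> {i<..j}. R i h}"
    and root: "\<And>S. S \<subseteq> {..<m} \<Longrightarrow> card S = d0 \<Longrightarrow>
      \<exists>h. inj_on h V0 \<and> h ` V0 \<subseteq> S \<and> (\<forall>u\<in>V0. \<forall>v\<in>V0. A u v \<longrightarrow> R (h u) (h v))"
    and block: "\<And>x S. x \<in> V \<Longrightarrow> S \<subseteq> {..<m} \<Longrightarrow> card S = d x \<Longrightarrow>
      \<exists>h. inj_on h (B x) \<and> h ` B x \<subseteq> S \<and> (\<forall>u\<in>B x. \<forall>v\<in>B x. A u v \<longrightarrow> R (h u) (h v))"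
    and room: "2 * d0 + (\<Sum>x\<in>V. 2 * d x - 1) \<le> m + 1"
  obtains g where "inj_on g V" "g ` V \<subseteq> {..<m}" "\<And>z. z \<in> V - V0 \<Longrightarrow> R (g (host z)) (g z)"
    "\<And>u v. u \<in> V0 \<Longrightarrow> v \<in> V0 \<Longrightarrow> A u v \<Longrightarrow> R (g u) (g v)"
    "\<And>x u v. u \<in> B x \<Longrightarrow> v \<in> B x \<Longrightarrow> A u v \<Longrightarrow> R (g u) (g v)"
proof -
  \<comment> \<open>\<open>rest\<close> is the room reserved for the nodes not yet met by the scan,
    placed or not. In \<open>good\<close>, the placed set \<open>W\<close> consists of the root
    block and the nodes whose host has been met.\<close>
  define rest where "rest = (\<lambda>(i::nat) W (g :: nat \<Rightarrow> nat). \<Sum>x\<in>V - {x \<in> W. g x < i}. 2 * d x - (1::nat))"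
  define good where "good = (\<lambda>i W (g :: nat \<Rightarrow> nat). V0 \<subseteq> W \<and> W \<subseteq> V \<and> inj_on g W \<and> g ` W \<subseteq> {..<m}
    \<and> W = V0 \<union> {z \<in> V - V0. host z \<in> W \<and> g (host z) < i}
    \<and> (\<forall>z\<in>W - V0. R (g (host z)) (g z))
    \<and> (\<forall>u\<in>V0. \<forall>v\<in>V0. A u v \<longrightarrow> R (g u) (g v))
    \<and> (\<forall>x. \<forall>u\<in>B x \<inter> W. \<forall>v\<in>B x \<inter> W. A u v \<longrightarrow> R (g u) (g v)))"
  \<comment> \<open>A node with \<open>d > 0\<close> takes up to \<open>2 * d\<close> of the remaining room, whereas its own position,
    once passed, returns 2 and costs 1 step of the scan; this is where \<open>2 * d - 1\<close> comes from.
    If the scan meets an unused position, the room shrinks by 1; \<open>dense\<close> pays for such steps as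
    long as a used position lies ahead. If none does, the embedding is already complete.\<close>
  define room_at where "room_at = (\<lambda>i W g. 2 * card (g ` W \<inter> {i..<m}) + rest i W g + i \<le> m + 1)"
  define dense where "dense = (\<lambda>i W g. \<forall>j\<ge>i. (\<exists>h\<in>g ` W. j < h) \<longrightarrow>
    card ({i..j} - g ` W) + 2 * card (g ` W \<inter> {i..<m}) + rest i W g + i
      \<le> card ({i..j} \<inter> g ` W) + m + 1)"
  \<comment> \<open>Hosts have smaller numbers, so a least unplaced node would have a placed host,
    which the scan has met by assumption.\<close>
  have complete: "W = V" if "good i W g" and processed: "\<And>x. x \<in> W \<Longrightarrow> g x < i" for i W g
  proof -
    have "z \<in> W" if "z \<in> V" for z
      using that
    proof (induction z rule: less_induct)
      case (less z)
      show ?case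
      proof (cases "z \<in> V0")
        case True then show ?thesis using \<open>good i W g\<close> by (auto simp: good_def)
      next
        case False
        then have "host z \<in> W" using less host by blast
        then have "g (host z) < i" using processed by blast
        have "W = V0 \<union> {z \<in> V - V0. host z \<in> W \<and> g (host z) < i}"
          using \<open>good i W g\<close> unfolding good_def by blast
        then show ?thesis using False less.prems \<open>host z \<in> W\<close> \<open>g (host z) < i\<close> by blast
      qed
    qed
    then show ?thesis using \<open>good i W g\<close> by (auto simp: good_def)
  qed
  have "\<exists>W g. good i W g \<and> room_at i W g \<and> dense i W g" if "i \<le> m" for i
    using that
  proof (induction i)
    case 0
    \<comment> \<open>A nonempty root block does not fit into zero slots. With \<open>d0\<close>
      positive, \<open>2 * d0 \<le> m + 1\<close> yields \<open>d0 \<le> m\<close>, so the first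
      \<open>d0\<close> positions exist.\<close>
    have "d0 \<noteq> 0"
    proof
      assume "d0 = 0"
      then obtain h where "h ` V0 \<subseteq> ({} :: nat set)" using root[of "{}"] by auto
      then show False using V0 by auto
    qed
    then have d0m: "d0 \<le> m" using room by linarith
    then obtain h where h: "inj_on h V0" "h ` V0 \<subseteq> {..<d0}"
      "\<forall>u\<in>V0. \<forall>v\<in>V0. A u v \<longrightarrow> R (h u) (h v)"
      using root[of "{..<d0}"] by auto
    have cV0: "card (h ` V0) \<le> d0" using card_mono[OF _ h(2)] by simp
    have int: "h ` V0 \<inter> {0..<m} = h ` V0" using h(2) d0m by auto
    have rest: "rest 0 V0 h = (\<Sum>x\<in>V. 2 * d x - 1)" by (simp add: rest_def)
    have "good 0 V0 h" using V0 h d0m by (auto simp: good_def B_def)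
    moreover have "room_at 0 V0 h" using room cV0 by (simp add: room_at_def rest int)
    moreover have "dense 0 V0 h"
      unfolding dense_def int rest
    proof (intro allI impI)
      fix j assume "\<exists>x\<in>h ` V0. j < x"
      then have "j < d0" using h(2) by auto
      then have "card ({0..j} - h ` V0) \<le> card ({..<d0} - h ` V0)"
        by (intro card_mono) auto
      also have "\<dots> = d0 - card (h ` V0)"
        using h(2) by (simp add: card_Diff_subset finite_subset[OF h(2)])
      finally show "card ({0..j} - h ` V0) + 2 * card (h ` V0) + (\<Sum>x\<in>V. 2 * d x - 1) + 0
          \<le> card ({0..j} \<inter> h ` V0) + m + 1"
        using room cV0 by linarith
    qed
    ultimately show ?case by blast
  next
    case (Suc i)
    then obtain W g where good: "good i W g" and ra: "room_at i W g" and dn: "dense i W g" by auto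
    have finW: "finite W" using good finV finite_subset by (auto simp: good_def)
    have inj: "inj_on g W" and gm: "g ` W \<subseteq> {..<m}" and WV: "W \<subseteq> V" and V0W: "V0 \<subseteq> W"
      using good by (auto simp: good_def)
    have closed: "W = V0 \<union> {z \<in> V - V0. host z \<in> W \<and> g (host z) < i}"
      using good unfolding good_def by blast
    have arcs: "\<forall>z\<in>W - V0. R (g (host z)) (g z)"
      "\<forall>u\<in>V0. \<forall>v\<in>V0. A u v \<longrightarrow> R (g u) (g v)"
      "\<forall>x. \<forall>u\<in>B x \<inter> W. \<forall>v\<in>B x \<inter> W. A u v \<longrightarrow> R (g u) (g v)"
      using good unfolding good_def by blast+
    define Oc where "Oc = g ` W"
    have finO: "finite Oc" using finW by (simp add: Oc_def)
    show ?case
    proof (cases "i \<in> Oc")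
      case False
      have ni: "g x \<noteq> i" if "x \<in> W" for x using False that by (auto simp: Oc_def)
      have lt: "g x < Suc i \<longleftrightarrow> g x < i" if "x \<in> W" for x using ni[OF that] by auto
      have "rest (Suc i) W g = rest i W g"
        unfolding rest_def using lt by (intro sum.cong) auto
      moreover have good': "good (Suc i) W g"
      proof -
        have eq: "{z \<in> V - V0. host z \<in> W \<and> g (host z) < i}
            = {z \<in> V - V0. host z \<in> W \<and> g (host z) < Suc i}" using lt by blast
        have "good i W g \<longleftrightarrow> good (Suc i) W g" unfolding good_def eq ..
        then show ?thesis using good by blast
      qed
      moreover have int: "Oc \<inter> {Suc i..<m} = Oc \<inter> {i..<m}"
        using False Suc.prems by (auto simp: Suc_le_eq le_less)
      moreover have "dense (Suc i) W g"
        unfolding dense_def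
      proof (intro allI impI)
        fix j assume j: "Suc i \<le> j" "\<exists>h\<in>g ` W. j < h"
        have eq: "{i..j} - Oc = insert i ({Suc i..j} - Oc)" "{i..j} \<inter> Oc = {Suc i..j} \<inter> Oc"
          using False j by (auto simp: Suc_le_eq le_less)
        have "card ({i..j} - Oc) = Suc (card ({Suc i..j} - Oc))" unfolding eq by simp
        then show "card ({Suc i..j} - g ` W) + 2 * card (g ` W \<inter> {Suc i..<m}) + rest (Suc i) W g + Suc i
            \<le> card ({Suc i..j} \<inter> g ` W) + m + 1"
          using dn[unfolded dense_def, rule_format, of j] j int eq \<open>rest (Suc i) W g = rest i W g\<close>
          by (simp add: Oc_def)
      qed
      moreover have "room_at (Suc i) W g"
      proof (cases "\<exists>h\<in>Oc. i < h")
        case True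
        have "{i..i} - Oc = {i}" "{i..i} \<inter> Oc = {}" using False by auto
        then have "card ({i..i} - Oc) = 1" "card ({i..i} \<inter> Oc) = 0" by simp_all
        then show ?thesis
          using dn[unfolded dense_def, rule_format, of i] True int \<open>rest (Suc i) W g = rest i W g\<close>
          by (simp add: room_at_def Oc_def)
      next
        case none: False
        then have lt': "g x < i" if "x \<in> W" for x
          using that ni[OF that] by (auto simp: Oc_def not_less)
        have "W = V" using complete[OF good] lt' by blast
        then have none_left: "V - {x \<in> W. g x < i} = {}" using lt' by blast
        have "rest i W g = 0" unfolding rest_def none_left by simp
        moreover have "Oc \<inter> {Suc i..<m} = {}" using none by (auto simp: Suc_le_eq)
        ultimately show ?thesis
          using Suc.prems \<open>rest (Suc i) W g = rest i W g\<close> by (simp add: room_at_def Oc_def)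
      qed
      ultimately show ?thesis by blast
    next
      case True
      then obtain x where x: "x \<in> W" "g x = i" by (auto simp: Oc_def)
      have xV: "x \<in> V" using x WV by auto
      have unq: "y = x" if "y \<in> W" "g y = i" for y using inj_onD[OF inj] that x by auto
      have upto: "{y \<in> W. g y < Suc i} = insert x {y \<in> W. g y < i}"
        using x by (auto simp: less_Suc_eq dest: unq)
      define q where "q = card (Oc \<inter> {Suc i..<m})"
      have im: "i < m" using Suc.prems by simp
      have qi: "card (Oc \<inter> {i..<m}) = Suc q"
      proof -
        have "Oc \<inter> {i..<m} = insert i (Oc \<inter> {Suc i..<m})" using True im by auto
        then show ?thesis by (simp add: q_def)
      qed
      define s where "s = (\<Sum>x\<in>V - {y \<in> W. g y < Suc i}. 2 * d x - 1)"
      define t where "t = 2 * d x - 1"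
      have t: "2 * d x \<le> t + 1" by (simp add: t_def)
      have ri: "rest i W g = t + s"
      proof -
        have "V - {y \<in> W. g y < i} = insert x (V - {y \<in> W. g y < Suc i})"
          unfolding upto using x xV by auto
        then show ?thesis unfolding rest_def s_def t_def using x finV by (simp add: sum.insert_if)
      qed
      have e: "2 * q + t + s + i + 1 \<le> m"
        using ra by (simp add: room_at_def ri qi Oc_def[symmetric])
      define F where "F = {h \<in> {i<..<m}. R i h} - Oc"
      have finF: "finite F" by (simp add: F_def)
      have "m - 1 - i \<le> 2 * card {h \<in> {i<..m-1}. R i h}"
        using median[of i "m-1"] im by (cases "i < m - 1") auto
      then have out: "m \<le> 2 * card {h \<in> {i<..m-1}. R i h} + i + 1" by linarith
      \<comment> \<open>Half of the positions after \<open>i\<close> are out-neighbours and at most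
        \<open>q\<close> of them are taken, so \<open>e\<close> leaves
        \<open>t \<le> 2 * card F\<close>. Hence \<open>2 * d x \<le> 2 * card F + 1\<close>, and
        parity absorbs the 1.\<close>
      have dF: "d x \<le> card F"
      proof -
        have "{h \<in> {i<..m-1}. R i h} \<subseteq> F \<union> (Oc \<inter> {Suc i..<m})" by (auto simp: F_def)
        then have "card {h \<in> {i<..m-1}. R i h} \<le> card (F \<union> (Oc \<inter> {Suc i..<m}))"
          using finF by (intro card_mono) auto
        also have "\<dots> \<le> card F + q" unfolding q_def by (rule card_Un_le)
        finally show ?thesis using out e t by linarith
      qed
      obtain S where S: "S \<subseteq> F" "card S = d x" "\<And>a b. a \<in> S \<Longrightarrow> b \<in> F \<Longrightarrow> b < a \<Longrightarrow> b \<in> S"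
        using initial_subset_with_card[OF finF dF] by metis
      have finS: "finite S" using S finF finite_subset by blast
      have "S \<subseteq> {..<m}" using S by (auto simp: F_def)
      then obtain h where h: "inj_on h (B x)" "h ` B x \<subseteq> S"
        "\<forall>u\<in>B x. \<forall>v\<in>B x. A u v \<longrightarrow> R (h u) (h v)"
        using block[OF xV _ S(2)] by blast
      have hF: "h z \<in> F" if "z \<in> B x" for z using h S that by blast
      have BW: "B x \<inter> W = {}"
      proof -
        have "z \<notin> W" if "z \<in> B x" for z
        proof
          assume "z \<in> W"
          then have "g (host z) < i" using closed that by (auto simp: B_def)
          then show False using that x by (auto simp: B_def)
        qed
        then show ?thesis by blast
      qed
      define g' where "g' = (\<lambda>z. if z \<in> B x then h z else g z)"
      define W' where "W' = W \<union> B x"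
      define N where "N = h ` B x"
      have g'W: "g' z = g z" if "z \<in> W" for z using that BW by (auto simp: g'_def)
      have g'B: "g' z = h z" if "z \<in> B x" for z using that by (auto simp: g'_def)
      have img: "g' ` W' = Oc \<union> N" using g'W g'B unfolding W'_def Oc_def N_def by (simp add: image_Un)
      have NF: "N \<subseteq> S" "N \<subseteq> F" using h S by (auto simp: N_def)
      have NO: "N \<inter> Oc = {}" "i \<notin> N" "N \<subseteq> {Suc i..<m}" using NF by (auto simp: F_def)
      have finN: "finite N" using NF finS finite_subset by blast
      have cN: "card N \<le> d x" using card_mono[OF finS NF(1)] S by simp
      have g'lt: "z \<in> W' \<and> g' z < Suc i \<longleftrightarrow> z \<in> W \<and> g z < Suc i" for z
        using hF[of z] g'W[of z] g'B[of z] by (auto simp: W'_def F_def)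
      have BV: "B x \<subseteq> V" by (auto simp: B_def)
      have hx: "z \<in> V - V0 \<and> host z = x" if "z \<in> B x" for z using that by (auto simp: B_def)
      have closed': "W' = V0 \<union> {z \<in> V - V0. host z \<in> W' \<and> g' (host z) < Suc i}"
      proof -
        have "{z \<in> V - V0. host z \<in> W' \<and> g' (host z) < Suc i}
            = {z \<in> V - V0. host z \<in> W \<and> g (host z) < Suc i}" using g'lt by blast
        also have "\<dots> = {z \<in> V - V0. host z \<in> W \<and> g (host z) < i} \<union> B x"
          using upto hx unfolding B_def by blast
        finally show ?thesis using closed unfolding W'_def by blast
      qed
      have good': "good (Suc i) W' g'"
        unfolding good_def
      proof (intro conjI ballI allI impI)
        show "V0 \<subseteq> W'" using V0W by (auto simp: W'_def)
        show "W' \<subseteq> V" using WV BV by (auto simp: W'_def)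
        show "inj_on g' W'"
        proof -
          have "inj_on g' W" using inj g'W by (simp cong: inj_on_cong)
          moreover have "inj_on g' (B x)" using h(1) g'B by (simp cong: inj_on_cong)
          moreover have "g' ` W = Oc" "g' ` B x = N"
            using g'W g'B unfolding Oc_def N_def by auto
          ultimately show ?thesis unfolding W'_def using NO(1) by (auto simp: inj_on_Un)
        qed
        show "g' ` W' \<subseteq> {..<m}" unfolding img using gm NO(3) by (auto simp: Oc_def)
        show "W' = V0 \<union> {z \<in> V - V0. host z \<in> W' \<and> g' (host z) < Suc i}" by (rule closed')
      next
        fix z assume z: "z \<in> W' - V0"
        show "R (g' (host z)) (g' z)"
        proof (cases "z \<in> W")
          case True
          then have "host z \<in> W" using closed z by blast
          then show ?thesis using True z arcs(1) g'W by simp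
        next
          case False
          then have zB: "z \<in> B x" using z by (auto simp: W'_def)
          then have "g' (host z) = i" using g'W x by (auto simp: B_def)
          then show ?thesis using hF[OF zB] g'B[OF zB] by (auto simp: F_def)
        qed
      next
        fix u v assume "u \<in> V0" "v \<in> V0" "A u v"
        then show "R (g' u) (g' v)" using arcs(2) V0W g'W by (simp add: subset_iff)
      next
        fix y u v assume uv: "u \<in> B y \<inter> W'" "v \<in> B y \<inter> W'" "A u v"
        show "R (g' u) (g' v)"
        proof (cases "y = x")
          case True
          then show ?thesis using uv h(3) g'B by auto
        next
          case False
          then have "u \<in> B y \<inter> W" "v \<in> B y \<inter> W" using uv by (auto simp: W'_def B_def)
          then have "R (g u) (g v)" using arcs(3) uv(3) by blast
          then show ?thesis using uv g'W \<open>u \<in> B y \<inter> W\<close> \<open>v \<in> B y \<inter> W\<close> by simp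
        qed
      qed
      have rest': "rest (Suc i) W' g' = s"
      proof -
        have "{y \<in> W'. g' y < Suc i} = {y \<in> W. g y < Suc i}" using g'lt by blast
        then show ?thesis by (simp add: rest_def s_def)
      qed
      have cO': "card (g' ` W' \<inter> {Suc i..<m}) = q + card N"
      proof -
        have "g' ` W' \<inter> {Suc i..<m} = (Oc \<inter> {Suc i..<m}) \<union> N" using img NO by auto
        moreover have "(Oc \<inter> {Suc i..<m}) \<inter> N = {}" using NO(1) by blast
        ultimately show ?thesis unfolding q_def using finN finO by (simp add: card_Un_disjoint)
      qed
      have ra': "room_at (Suc i) W' g'"
        using e t cN by (simp add: room_at_def cO' rest')
      moreover have "dense (Suc i) W' g'"
        unfolding dense_def cO' rest'
      proof (intro allI impI)
        fix j assume j: "Suc i \<le> j" and ex: "\<exists>h\<in>g' ` W'. j < h"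
        define nj where "nj = card (N \<inter> {Suc i..j})"
        define len where "len = j - i"
        define oc where "oc = card (Oc \<inter> {Suc i..j})"
        have jm: "j < m"
          using ex img gm NO(3) by (auto simp: Oc_def)
        have occ: "card ({Suc i..j} \<inter> g' ` W') = oc + nj"
        proof -
          have "{Suc i..j} \<inter> g' ` W' = (Oc \<inter> {Suc i..j}) \<union> (N \<inter> {Suc i..j})" using img by auto
          then show ?thesis unfolding oc_def nj_def
            using NO finN finO by (subst card_Un_disjoint[symmetric]) auto
        qed
        have free: "card ({Suc i..j} - g' ` W') + (oc + nj) = len"
        proof -
          have "card ({Suc i..j} - g' ` W') + card ({Suc i..j} \<inter> g' ` W') = card {Suc i..j}"
            by (metis add.commute card_Diff_subset_Int card_mono finite_Int finite_atLeastAtMost inf_le1 le_add_diff_inverse)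
          then show ?thesis using occ by (simp add: len_def)
        qed
        \<comment> \<open>Either all chosen slots are at most \<open>j\<close>, and the old invariant applies at \<open>j\<close>; or all
          out-neighbours of \<open>i\<close> up to \<open>j\<close> are taken, so that by the median property at least
          half of the interval is.\<close>
        show "card ({Suc i..j} - g' ` W') + 2 * (q + card N) + s + Suc i
            \<le> card ({Suc i..j} \<inter> g' ` W') + m + 1"
        proof (cases "S \<subseteq> {..j}")
          case True
          have "N \<subseteq> {..j}" using True NF by blast
          then have "N \<inter> {Suc i..j} = N" using NO(3) by (auto simp: subset_iff)
          then have nj: "nj = card N" by (simp add: nj_def)
          have "\<exists>h\<in>Oc. j < h" using ex img \<open>N \<subseteq> {..j}\<close> by fastforce
          then have "card ({i..j} - Oc) + 2 * Suc q + (t + s) + i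
              \<le> card ({i..j} \<inter> Oc) + m + 1"
            using dn[unfolded dense_def, rule_format, of j] j by (simp add: Oc_def[symmetric] qi ri)
          moreover have "{i..j} \<inter> Oc = insert i (Oc \<inter> {Suc i..j})" using \<open>i \<in> Oc\<close> j by auto
          then have "card ({i..j} \<inter> Oc) = Suc oc" by (simp add: oc_def)
          moreover have "card ({i..j} - Oc) + oc = len"
          proof -
            have "{i..j} - Oc = {Suc i..j} - Oc" using \<open>i \<in> Oc\<close> by (auto simp: Suc_le_eq le_less)
            moreover have "card ({Suc i..j} - Oc) + card (Oc \<inter> {Suc i..j}) = card {Suc i..j}"
              by (metis Int_commute add.commute card_Diff_subset_Int card_mono finite_Int finite_atLeastAtMost inf_le1 le_add_diff_inverse)
            ultimately show ?thesis by (simp add: oc_def len_def)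
          qed
          ultimately show ?thesis using free occ nj by simp
        next
          case False
          then obtain a where a: "a \<in> S" "j < a" by (meson atMost_iff not_le subsetI)
          define sj where "sj = card (S \<inter> {Suc i..j})"
          have "{h \<in> {i<..j}. R i h} \<subseteq> (Oc \<inter> {Suc i..j}) \<union> (S \<inter> {Suc i..j})"
          proof
            fix y assume y: "y \<in> {h \<in> {i<..j}. R i h}"
            then have "y \<in> Oc \<or> y \<in> F" using jm by (auto simp: F_def)
            then show "y \<in> (Oc \<inter> {Suc i..j}) \<union> (S \<inter> {Suc i..j})"
              using S(3)[OF a(1), of y] a y by auto
          qed
          then have "card {h \<in> {i<..j}. R i h} \<le> card ((Oc \<inter> {Suc i..j}) \<union> (S \<inter> {Suc i..j}))"
            by (intro card_mono) auto
          also have "\<dots> \<le> oc + sj" unfolding oc_def sj_def by (rule card_Un_le)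
          finally have "len \<le> 2 * (oc + sj)" using median[of i j] j jm by (simp add: len_def)
          \<comment> \<open>A slot of \<open>S\<close> up to \<open>j\<close> is either used, hence
            counted by \<open>nj\<close>, or one of the \<open>d x - card N\<close> slots that the
            block leaves empty.\<close>
          moreover have "sj + card N \<le> nj + d x"
          proof -
            have "sj - nj \<le> card (S \<inter> {Suc i..j} - N \<inter> {Suc i..j})"
              unfolding sj_def nj_def by (rule diff_card_le_card_Diff) simp
            also have "\<dots> \<le> card (S - N)" using finS by (intro card_mono) auto
            also have "\<dots> = d x - card N" using S(2) NF finN by (simp add: card_Diff_subset)
            finally show ?thesis using cN by linarith
          qed
          ultimately show ?thesis using free occ e t by simp
        qed
      qed
      ultimately show ?thesis using good' by blast
    qed
  qed
  then obtain W g where good: "good m W g" by blast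
  then have "g ` W \<subseteq> {..<m}" unfolding good_def by (elim conjE)
  \<comment> \<open>At the end of the scan every image lies below \<open>m\<close>, so all placed
    nodes have been met.\<close>
  then have WV: "W = V" using complete[OF good] by blast
  have g: "inj_on g V" "g ` V \<subseteq> {..<m}" "\<forall>z\<in>V - V0. R (g (host z)) (g z)"
    "\<forall>u\<in>V0. \<forall>v\<in>V0. A u v \<longrightarrow> R (g u) (g v)"
    "\<forall>x. \<forall>u\<in>B x \<inter> V. \<forall>v\<in>B x \<inter> V. A u v \<longrightarrow> R (g u) (g v)"
    using good unfolding good_def WV by blast+
  show ?thesis
  proof (rule that[OF g(1,2)])
    fix x u v assume "u \<in> B x" "v \<in> B x" "A u v"
    moreover have "B x \<subseteq> V" by (auto simp: B_def)
    ultimately show "R (g u) (g v)" using g(5) by blast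
  qed (use g(3,4) in blast)+
qed

text \<open>Positions in a local median order of \<open>X\<close> stand in for its vertices. The
  embedding hypotheses speak of all slot sets of a given size, so they carry over along the
  bijection between positions and vertices.\<close>

lemma tournament_block_embedding:
  fixes V V0 :: "nat set" and host d :: "nat \<Rightarrow> nat" and A :: "nat \<Rightarrow> nat \<Rightarrow> bool"
    and R :: "'b \<Rightarrow> 'b \<Rightarrow> bool"
  defines "B \<equiv> \<lambda>x. {z \<in> V - V0. host z = x}"
  assumes "finite V" "V0 \<subseteq> V" "V0 \<noteq> {}"
    and host: "\<And>z. z \<in> V - V0 \<Longrightarrow> host z \<in> V \<and> host z < z"
    and "finite X" and total: "\<And>a b. a \<in> X \<Longrightarrow> b \<in> X \<Longrightarrow> a \<noteq> b \<Longrightarrow> R a b \<or> R b a"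
    and root: "\<And>S. S \<subseteq> X \<Longrightarrow> card S = d0 \<Longrightarrow>
      \<exists>h. inj_on h V0 \<and> h ` V0 \<subseteq> S \<and> (\<forall>u\<in>V0. \<forall>v\<in>V0. A u v \<longrightarrow> R (h u) (h v))"
    and block: "\<And>x S. x \<in> V \<Longrightarrow> S \<subseteq> X \<Longrightarrow> card S = d x \<Longrightarrow>
      \<exists>h. inj_on h (B x) \<and> h ` B x \<subseteq> S \<and> (\<forall>u\<in>B x. \<forall>v\<in>B x. A u v \<longrightarrow> R (h u) (h v))"
    and room: "2 * d0 + (\<Sum>x\<in>V. 2 * d x - 1) \<le> card X + 1"
  obtains g where "inj_on g V" "g ` V \<subseteq> X" "\<And>z. z \<in> V - V0 \<Longrightarrow> R (g (host z)) (g z)"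
    "\<And>u v. u \<in> V0 \<Longrightarrow> v \<in> V0 \<Longrightarrow> A u v \<Longrightarrow> R (g u) (g v)"
    "\<And>x u v. u \<in> B x \<Longrightarrow> v \<in> B x \<Longrightarrow> A u v \<Longrightarrow> R (g u) (g v)"
proof -
  obtain xs where xs: "distinct xs" "set xs = X"
    and median: "\<And>i j. i < j \<Longrightarrow> j < length xs \<Longrightarrow> j - i \<le> 2 * card {h \<in> {i<..j}. R (xs ! i) (xs ! h)}"
  proof (rule local_median_order[OF \<open>finite X\<close>, of R])
    show "R a b \<or> R b a" if "a \<in> X" "b \<in> X" "a \<noteq> b" for a b using total that by blast
  qed (rule that)
  define m where "m = length xs"
  define f where "f = (!) xs"
  have m: "card X = m" using xs distinct_card unfolding m_def by blast
  have bij: "bij_betw f {..<m} X" unfolding f_def m_def using bij_betw_nth[OF xs(1)] xs(2) by blast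
  have inj: "inj_on f {..<m}" and img: "f ` {..<m} = X" using bij by (auto simp: bij_betw_def)
  define Rp where "Rp = (\<lambda>i j. R (f i) (f j))"
  have medianp: "j - i \<le> 2 * card {h \<in> {i<..j}. Rp i h}" if "i < j" "j < m" for i j
    using median that by (simp add: Rp_def f_def m_def)
  have pull: "\<exists>h. inj_on h W \<and> h ` W \<subseteq> S \<and> (\<forall>u\<in>W. \<forall>v\<in>W. A u v \<longrightarrow> Rp (h u) (h v))"
    if S: "S \<subseteq> {..<m}" and h: "inj_on h W" "h ` W \<subseteq> f ` S"
      "\<forall>u\<in>W. \<forall>v\<in>W. A u v \<longrightarrow> R (h u) (h v)" for S h and W :: "nat set"
  proof (intro exI conjI)
    let ?p = "inv_into S f"
    have fp: "f (?p (h u)) = h u" if "u \<in> W" for u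
      by (rule f_inv_into_f) (use that h(2) in blast)
    show "inj_on (\<lambda>u. ?p (h u)) W"
      by (rule inj_onI) (metis fp h(1) inj_onD)
    show "(\<lambda>u. ?p (h u)) ` W \<subseteq> S" using h(2) inv_into_into[of _ f S] by blast
    show "\<forall>u\<in>W. \<forall>v\<in>W. A u v \<longrightarrow> Rp (?p (h u)) (?p (h v))"
      using h(3) fp by (simp add: Rp_def)
  qed
  have cards: "card (f ` S) = card S" "f ` S \<subseteq> X" if "S \<subseteq> {..<m}" for S
    using inj img that by (auto intro!: card_image intro: inj_on_subset)
  have rootp: "\<exists>h. inj_on h V0 \<and> h ` V0 \<subseteq> S \<and> (\<forall>u\<in>V0. \<forall>v\<in>V0. A u v \<longrightarrow> Rp (h u) (h v))"
    if S: "S \<subseteq> {..<m}" "card S = d0" for S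
  proof -
    obtain h where "inj_on h V0" "h ` V0 \<subseteq> f ` S" "\<forall>u\<in>V0. \<forall>v\<in>V0. A u v \<longrightarrow> R (h u) (h v)"
      using root[of "f ` S"] cards[OF S(1)] S(2) by auto
    then show ?thesis using pull S(1) by blast
  qed
  have blockp: "\<exists>h. inj_on h (B x) \<and> h ` B x \<subseteq> S \<and> (\<forall>u\<in>B x. \<forall>v\<in>B x. A u v \<longrightarrow> Rp (h u) (h v))"
    if S: "x \<in> V" "S \<subseteq> {..<m}" "card S = d x" for x S
  proof -
    obtain h where "inj_on h (B x)" "h ` B x \<subseteq> f ` S"
      "\<forall>u\<in>B x. \<forall>v\<in>B x. A u v \<longrightarrow> R (h u) (h v)"
      using block[OF S(1), of "f ` S"] cards[OF S(2)] S(3) by auto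
    then show ?thesis using pull S(2) by blast
  qed
  obtain g where g: "inj_on g V" "g ` V \<subseteq> {..<m}" "\<And>z. z \<in> V - V0 \<Longrightarrow> Rp (g (host z)) (g z)"
    "\<And>u v. u \<in> V0 \<Longrightarrow> v \<in> V0 \<Longrightarrow> A u v \<Longrightarrow> Rp (g u) (g v)"
    "\<And>x u v. u \<in> B x \<Longrightarrow> v \<in> B x \<Longrightarrow> A u v \<Longrightarrow> Rp (g u) (g v)"
    by (rule greedy_block_embedding
        [OF assms(2-4) host medianp rootp blockp[unfolded B_def] room[unfolded m]];
        (assumption | (rule that; simp add: B_def)))
  show ?thesis
  proof (rule that[of "f \<circ> g"])
    show "inj_on (f \<circ> g) V" using g(1,2) inj by (auto intro: comp_inj_on inj_on_subset)
    show "(f \<circ> g) ` V \<subseteq> X" using g(2) img by auto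
  qed (use g(3-5) in \<open>simp_all add: Rp_def\<close>)
qed

subsection \<open>Arborescences\<close>

text \<open>The blocks are the sets of children, with no arcs inside, so any bijection onto the
  slots embeds them. For \<open>n\<close> nodes of which \<open>l\<close> are childless, the room is
  n + l - 1: twice the n - 1 children, less 1 for each of the n - l parents, plus 1.\<close>

lemma arborescence_embedding:
  fixes V :: "nat set" and par :: "nat \<Rightarrow> nat" and R :: "'b \<Rightarrow> 'b \<Rightarrow> bool"
  assumes "finite V" "r \<in> V" and par: "\<And>z. z \<in> V - {r} \<Longrightarrow> par z \<in> V \<and> par z < z"
    and "finite X" and total: "\<And>a b. a \<in> X \<Longrightarrow> b \<in> X \<Longrightarrow> a \<noteq> b \<Longrightarrow> R a b \<or> R b a"
    and room: "1 + (\<Sum>x\<in>V. 2 * card {z \<in> V - {r}. par z = x} - 1) \<le> card X"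
  obtains g where "inj_on g V" "g ` V \<subseteq> X" "\<And>z. z \<in> V - {r} \<Longrightarrow> R (g (par z)) (g z)"
proof (rule tournament_block_embedding
    [of V "{r}" par X R 1 "\<lambda>_ _. False" "\<lambda>x. card {z \<in> V - {r}. par z = x}"])
  show "\<exists>h. inj_on h {r} \<and> h ` {r} \<subseteq> S \<and> (\<forall>u\<in>{r}. \<forall>v\<in>{r}. False \<longrightarrow> R (h u) (h v))"
    if "card S = 1" for S
    using that by (auto simp: card_1_singleton_iff)
  show "\<exists>h. inj_on h {z \<in> V - {r}. par z = x} \<and> h ` {z \<in> V - {r}. par z = x} \<subseteq> S \<and>
      (\<forall>u\<in>{z \<in> V - {r}. par z = x}. \<forall>v\<in>{z \<in> V - {r}. par z = x}. False \<longrightarrow> R (h u) (h v))"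
    if S: "S \<subseteq> X" "card S = card {z \<in> V - {r}. par z = x}" for x S
  proof -
    have "finite S" using S(1) \<open>finite X\<close> finite_subset by blast
    then obtain h where "bij_betw h {z \<in> V - {r}. par z = x} S"
      using finite_same_card_bij[of "{z \<in> V - {r}. par z = x}" S] \<open>finite V\<close> S(2) by auto
    then show ?thesis unfolding bij_betw_def by auto
  qed
  show "2 * 1 + (\<Sum>x\<in>V. 2 * card {z \<in> V - {r}. par z = x} - 1) \<le> card X + 1"
    using room by simp
qed (use assms(1-5) that in auto)

text \<open>The arborescences are disjoint and no required arc joins two of them, so
  \<open>X\<close> can be cut into separate slot sets, one for each.\<close>

lemma arborescence_forest_embedding:
  fixes C :: "nat \<Rightarrow> nat set" and par :: "nat \<Rightarrow> nat" and R :: "'b \<Rightarrow> 'b \<Rightarrow> bool"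
  assumes "finite I" and C: "\<And>w. w \<in> I \<Longrightarrow> finite (C w) \<and> w \<in> C w"
    and par: "\<And>w z. w \<in> I \<Longrightarrow> z \<in> C w - {w} \<Longrightarrow> par z \<in> C w \<and> par z < z"
    and disj: "\<And>v w. v \<in> I \<Longrightarrow> w \<in> I \<Longrightarrow> v \<noteq> w \<Longrightarrow> C v \<inter> C w = {}"
    and "finite X" and total: "\<And>a b. a \<in> X \<Longrightarrow> b \<in> X \<Longrightarrow> a \<noteq> b \<Longrightarrow> R a b \<or> R b a"
    and room: "(\<Sum>w\<in>I. 1 + (\<Sum>x\<in>C w. 2 * card {z \<in> C w - {w}. par z = x} - 1)) \<le> card X"
  shows "\<exists>g. inj_on g (\<Union>w\<in>I. C w) \<and> g ` (\<Union>w\<in>I. C w) \<subseteq> X \<and>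
    (\<forall>w\<in>I. \<forall>z\<in>C w - {w}. R (g (par z)) (g z))"
  using assms
proof (induction I arbitrary: X rule: finite_induct)
  case empty
  then show ?case by simp
next
  case (insert v I)
  define need where "need = (\<lambda>w. 1 + (\<Sum>x\<in>C w. 2 * card {z \<in> C w - {w}. par z = x} - 1))"
  have room: "need v + (\<Sum>w\<in>I. need w) \<le> card X"
    using insert.prems(6) insert.hyps by (simp add: need_def)
  obtain Y where Y: "Y \<subseteq> X" "card Y = need v" "finite Y"
    using obtain_subset_with_card_n[of "need v" X] room insert.prems(4) finite_subset by (metis add_leD1)
  obtain g where g: "inj_on g (C v)" "g ` C v \<subseteq> Y" "\<And>z. z \<in> C v - {v} \<Longrightarrow> R (g (par z)) (g z)"
  proof (rule arborescence_embedding[of "C v" v par Y R])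
    show "1 + (\<Sum>x\<in>C v. 2 * card {z \<in> C v - {v}. par z = x} - 1) \<le> card Y"
      using Y(2) by (simp add: need_def)
    show "R a b \<or> R b a" if "a \<in> Y" "b \<in> Y" "a \<noteq> b" for a b
      using insert.prems(5) that Y(1) by blast
  qed (use insert.prems(1,2) Y(3) in auto)
  have "\<exists>h. inj_on h (\<Union>w\<in>I. C w) \<and> h ` (\<Union>w\<in>I. C w) \<subseteq> X - Y \<and>
    (\<forall>w\<in>I. \<forall>z\<in>C w - {w}. R (h (par z)) (h z))"
  proof (rule insert.IH)
    have "card (X - Y) = card X - card Y" using Y by (simp add: card_Diff_subset)
    then show "(\<Sum>w\<in>I. 1 + (\<Sum>x\<in>C w. 2 * card {z \<in> C w - {w}. par z = x} - 1)) \<le> card (X - Y)"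
      using room Y(2) unfolding need_def by linarith
    show "R a b \<or> R b a" if "a \<in> X - Y" "b \<in> X - Y" "a \<noteq> b" for a b
      using insert.prems(5) that by blast
  qed (use insert.prems(1-4) in auto)
  then obtain h where h: "inj_on h (\<Union>w\<in>I. C w)" "h ` (\<Union>w\<in>I. C w) \<subseteq> X - Y"
    "\<forall>w\<in>I. \<forall>z\<in>C w - {w}. R (h (par z)) (h z)" by blast
  define f where "f = (\<lambda>z. if z \<in> C v then g z else h z)"
  have out: "z \<notin> C v" if "w \<in> I" "z \<in> C w" for w z
    using insert.prems(3)[of v w] insert.hyps(2) that by blast
  have fg: "f z = g z" if "z \<in> C v" for z using that by (simp add: f_def)
  have fh: "f z = h z" if "w \<in> I" "z \<in> C w" for w z using out[OF that] by (simp add: f_def)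
  have "inj_on f (C v)" using g(1) fg by (simp cong: inj_on_cong)
  moreover have "inj_on f (\<Union>w\<in>I. C w)"
    using h(1) fh by (subst inj_on_cong[where g = h]) auto
  moreover have img: "f ` C v = g ` C v" "f ` (\<Union>w\<in>I. C w) = h ` (\<Union>w\<in>I. C w)"
    using fg fh by (auto intro!: image_cong)
  moreover have "g ` C v \<inter> h ` (\<Union>w\<in>I. C w) = {}" using g(2) h(2) by blast
  ultimately have "inj_on f (C v \<union> (\<Union>w\<in>I. C w))" unfolding inj_on_Un by blast
  moreover have "f ` (C v \<union> (\<Union>w\<in>I. C w)) \<subseteq> X" unfolding image_Un img using g(2) h(2) Y(1) by blast
  moreover have "R (f (par z)) (f z)" if "w \<in> insert v I" "z \<in> C w - {w}" for w z
  proof (cases "w = v")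
    case True
    then show ?thesis using that g(3) insert.prems(2)[of v z] fg by auto
  next
    case False
    then have "w \<in> I" using that by blast
    then show ?thesis using that h(3) insert.prems(2)[of w z] fh by auto
  qed
  ultimately show ?case by auto
qed

subsection \<open>Rooted oriented trees\<close>

text \<open>Climbs along arcs towards the root until it reaches \<open>r\<close> or a node entered
  by a forward arc. The guard \<open>\<not> par z < z\<close> secures termination; it cannot fire
  where \<open>par\<close> decreases.\<close>

fun component_root :: "nat \<Rightarrow> (nat \<Rightarrow> bool) \<Rightarrow> (nat \<Rightarrow> nat) \<Rightarrow> nat \<Rightarrow> nat" where
  "component_root r fwd par z =
    (if z = r \<or> fwd z \<or> \<not> par z < z then z else component_root r fwd par (par z))"

declare component_root.simps [simp del]

text \<open>Backward children weigh double because they are counted inside a block: a component asks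
  for 1 plus the sum of its \<open>2 * bc x - 1\<close> as slots, and the greedy embedding charges
  two positions per slot. The 1 of each component, doubled and summed over the forward children of
  \<open>x\<close>, less the 1 regained at \<open>x\<close>, becomes
  \<open>2 * fc x - 1\<close>.\<close>

lemma rooted_tree_embedding:
  fixes V :: "nat set" and r :: nat and par :: "nat \<Rightarrow> nat" and fwd :: "nat \<Rightarrow> bool"
    and R :: "'b \<Rightarrow> 'b \<Rightarrow> bool"
  defines "fc \<equiv> \<lambda>x. card {z \<in> V - {r}. par z = x \<and> fwd z}"
    and "bc \<equiv> \<lambda>x. card {z \<in> V - {r}. par z = x \<and> \<not> fwd z}"
  assumes "finite V" "r \<in> V" and par: "\<And>z. z \<in> V - {r} \<Longrightarrow> par z \<in> V \<and> par z < z"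
    and "finite X" and total: "\<And>a b. a \<in> X \<Longrightarrow> b \<in> X \<Longrightarrow> a \<noteq> b \<Longrightarrow> R a b \<or> R b a"
    and room: "1 + (\<Sum>x\<in>V. (2 * fc x - 1) + 2 * (2 * bc x - 1)) \<le> card X"
  obtains g where "inj_on g V" "g ` V \<subseteq> X"
    "\<And>z. z \<in> V - {r} \<Longrightarrow> if fwd z then R (g (par z)) (g z) else R (g z) (g (par z))"
proof -
  define top where "top = component_root r fwd par"
  have top_root: "top z = z" if "z = r \<or> fwd z" for z
    unfolding top_def by (subst component_root.simps) (use that in auto)
  have top_par: "top z = top (par z)" if "z \<in> V - {r}" "\<not> fwd z" for z
    unfolding top_def by (subst component_root.simps) (use that par[of z] in simp)
  define I where "I = {w \<in> V. w = r \<or> fwd w}"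
  have top: "top z \<in> I \<and> top z \<le> z" if "z \<in> V" for z
    using that
  proof (induction z rule: less_induct)
    case (less z)
    show ?case
    proof (cases "z = r \<or> fwd z")
      case True
      then show ?thesis using top_root less.prems by (simp add: I_def)
    next
      case False
      then have "par z \<in> V" "par z < z" "top z = top (par z)" using par top_par less.prems by auto
      then show ?thesis using less.IH[of "par z"] by simp
    qed
  qed
  define C where "C = (\<lambda>w. {z \<in> V. top z = w})"
  define F where "F = (\<lambda>x. {w \<in> V - {r}. par w = x \<and> fwd w})"
  \<comment> \<open>The host of \<open>z\<close> is the node above its entire component rather than
    its parent, so the whole component lands among the out-neighbours of one node. For
    \<open>z = top z\<close> this yields the forward arc from \<open>par z\<close>.\<close>
  define host where "host = (\<lambda>z. par (top z))"
  define A where "A = (\<lambda>u v. u \<in> V - {r} \<and> \<not> fwd u \<and> v = par u)"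
  define b where "b = (\<lambda>x. 2 * bc x - 1)"
  define need where "need = (\<lambda>w. 1 + (\<Sum>x\<in>C w. b x))"
  define d where "d = (\<lambda>x. \<Sum>w\<in>F x. need w)"
  have FI: "F x \<subseteq> I" for x by (auto simp: F_def I_def)
  have rI: "r \<in> I" using \<open>r \<in> V\<close> by (simp add: I_def)
  have finC: "finite (C w)" and finF: "finite (F w)" for w
    using \<open>finite V\<close> by (auto simp: C_def F_def)
  have topI: "top w = w" if "w \<in> I" for w using top_root that by (auto simp: I_def)
  have CI: "finite (C w) \<and> w \<in> C w" if "w \<in> I" for w
    using that topI finC by (auto simp: C_def I_def)
  have Cpar: "z \<in> V - {r} \<and> \<not> fwd z \<and> par z \<in> C w \<and> par z < z" if "w \<in> I" "z \<in> C w - {w}" for w z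
  proof -
    have z: "z \<in> V" "top z = w" "z \<noteq> w" using that by (auto simp: C_def)
    then have "\<not> (z = r \<or> fwd z)" using top_root[of z] by metis
    then show ?thesis using z par[of z] top_par[of z] by (simp add: C_def)
  qed
  have Cchild: "{z \<in> C w - {w}. par z = x} = {z \<in> V - {r}. par z = x \<and> \<not> fwd z}"
    if "w \<in> I" "x \<in> C w" for w x
  proof (intro equalityI subsetI)
    fix z assume "z \<in> {z \<in> V - {r}. par z = x \<and> \<not> fwd z}"
    then have z: "z \<in> V - {r}" "par z = x" "\<not> fwd z" by auto
    then have "top z = w" using top_par[of z] that(2) by (simp add: C_def)
    moreover have "z \<noteq> w" using that(1) z by (auto simp: I_def)
    ultimately show "z \<in> {z \<in> C w - {w}. par z = x}" using z by (simp add: C_def)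
  qed (use Cpar[OF that(1)] in auto)
  have need: "1 + (\<Sum>x\<in>C w. 2 * card {z \<in> C w - {w}. par z = x} - 1) = need w" if "w \<in> I" for w
    unfolding need_def b_def bc_def using Cchild[OF that] by (simp cong: sum.cong)
  have disj: "C v \<inter> C w = {}" if "v \<noteq> w" for v w using that by (auto simp: C_def)
  have forest: "\<exists>h. inj_on h (\<Union>w\<in>J. C w) \<and> h ` (\<Union>w\<in>J. C w) \<subseteq> S \<and>
      (\<forall>u\<in>\<Union>w\<in>J. C w. \<forall>v\<in>\<Union>w\<in>J. C w. A u v \<longrightarrow> R (h u) (h v))"
    if J: "finite J" "J \<subseteq> I" and S: "S \<subseteq> X" "card S = (\<Sum>w\<in>J. need w)" for J S
  proof -
    have "\<exists>g. inj_on g (\<Union>w\<in>J. C w) \<and> g ` (\<Union>w\<in>J. C w) \<subseteq> S \<and>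
      (\<forall>w\<in>J. \<forall>z\<in>C w - {w}. R (g z) (g (par z)))"
    proof (rule arborescence_forest_embedding[where R = "\<lambda>u v. R v u"])
      show "finite (C w) \<and> w \<in> C w" if "w \<in> J" for w using CI that J(2) by blast
      show "par z \<in> C w \<and> par z < z" if "w \<in> J" "z \<in> C w - {w}" for w z
        using Cpar[of w z] that J by blast
      show "R b a \<or> R a b" if "a \<in> S" "b \<in> S" "a \<noteq> b" for a b
        using total[of a b] that S(1) by blast
      have "(\<Sum>w\<in>J. 1 + (\<Sum>x\<in>C w. 2 * card {z \<in> C w - {w}. par z = x} - 1)) = (\<Sum>w\<in>J. need w)"
        using need J(2) by (intro sum.cong) auto
      then show "(\<Sum>w\<in>J. 1 + (\<Sum>x\<in>C w. 2 * card {z \<in> C w - {w}. par z = x} - 1)) \<le> card S"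
        using S(2) by simp
      show "finite S" using S(1) \<open>finite X\<close> finite_subset by blast
    qed (use J(1) disj in blast)+
    then obtain h where h: "inj_on h (\<Union>w\<in>J. C w)" "h ` (\<Union>w\<in>J. C w) \<subseteq> S"
      "\<forall>w\<in>J. \<forall>z\<in>C w - {w}. R (h z) (h (par z))" by (elim exE conjE)
    moreover have "R (h u) (h v)" if "w \<in> J" "u \<in> C w" "A u v" for u v w
    proof -
      have "u \<noteq> w" using that J(2) by (auto simp: A_def I_def)
      then show ?thesis using h(3)[rule_format, OF that(1), of u] that by (simp add: A_def)
    qed
    ultimately show ?thesis by blast
  qed
  have block_eq: "{z \<in> V - C r. host z = x} = (\<Union>w\<in>F x. C w)" for x
  proof (intro equalityI subsetI)
    fix z assume "z \<in> {z \<in> V - C r. host z = x}"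
    then have "z \<in> C (top z)" "top z \<in> F x"
      using top[of z] by (auto simp: C_def F_def host_def I_def)
    then show "z \<in> (\<Union>w\<in>F x. C w)" by blast
  qed (auto simp: C_def F_def host_def)
  \<comment> \<open>The components partition \<open>V\<close>, and each one except that of
    \<open>r\<close> hangs from exactly one node, the parent of its root. So every
    \<open>b x\<close> is charged once over the root block and all hosted blocks.\<close>
  have b_total: "(\<Sum>w\<in>I. \<Sum>x\<in>C w. b x) = (\<Sum>x\<in>V. b x)"
    using sum.group[of V I top b] \<open>finite V\<close> top by (simp add: C_def I_def image_subset_iff)
  have d_total: "(\<Sum>x\<in>V. \<Sum>w\<in>F x. \<Sum>y\<in>C w. b y) = (\<Sum>w\<in>I - {r}. \<Sum>y\<in>C w. b y)"
  proof -
    have "F x = {w \<in> I - {r}. par w = x}" for x by (auto simp: F_def I_def)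
    moreover have "par ` (I - {r}) \<subseteq> V" using par by (auto simp: I_def)
    ultimately show ?thesis
      using sum.group[of "I - {r}" V par "\<lambda>w. \<Sum>y\<in>C w. b y"] \<open>finite V\<close> by (simp add: I_def)
  qed
  have fcF: "fc x = card (F x)" for x by (simp add: fc_def F_def)
  \<comment> \<open>Without forward children both sides vanish by truncation; otherwise at least one
    slot is requested and the subtraction is exact.\<close>
  have "2 * d x - 1 = (2 * fc x - 1) + 2 * (\<Sum>w\<in>F x. \<Sum>y\<in>C w. b y)" for x
  proof (cases "F x = {}")
    case True
    then show ?thesis by (simp add: d_def fcF)
  next
    case False
    then have "card (F x) > 0" using finF by (simp add: card_gt_0_iff)
    moreover have "d x = card (F x) + (\<Sum>w\<in>F x. \<Sum>y\<in>C w. b y)"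
      unfolding d_def need_def by (simp only: sum.distrib card_eq_sum)
    ultimately show ?thesis by (simp add: fcF)
  qed
  then have "2 * need r + (\<Sum>x\<in>V. 2 * d x - 1)
      = 2 + (\<Sum>x\<in>V. 2 * fc x - 1) + 2 * ((\<Sum>y\<in>C r. b y) + (\<Sum>w\<in>I - {r}. \<Sum>y\<in>C w. b y))"
    by (simp add: need_def sum.distrib sum_distrib_left[symmetric] d_total)
  also have "(\<Sum>y\<in>C r. b y) + (\<Sum>w\<in>I - {r}. \<Sum>y\<in>C w. b y) = (\<Sum>x\<in>V. b x)"
    using b_total sum.remove[of I r "\<lambda>w. \<Sum>y\<in>C w. b y"] rI \<open>finite V\<close> by (simp add: I_def)
  also have "2 + (\<Sum>x\<in>V. 2 * fc x - 1) + 2 * (\<Sum>x\<in>V. b x) \<le> card X + 1"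
    using room by (simp add: sum.distrib sum_distrib_left b_def)
  finally have room': "2 * need r + (\<Sum>x\<in>V. 2 * d x - 1) \<le> card X + 1" .
  have root_emb: "\<exists>h. inj_on h (C r) \<and> h ` C r \<subseteq> S \<and> (\<forall>u\<in>C r. \<forall>v\<in>C r. A u v \<longrightarrow> R (h u) (h v))"
    if "S \<subseteq> X" "card S = need r" for S
    using forest[of "{r}" S] that rI by simp
  have block_emb: "\<exists>h. inj_on h {z \<in> V - C r. host z = x} \<and> h ` {z \<in> V - C r. host z = x} \<subseteq> S \<and>
      (\<forall>u\<in>{z \<in> V - C r. host z = x}. \<forall>v\<in>{z \<in> V - C r. host z = x}. A u v \<longrightarrow> R (h u) (h v))"
    if "S \<subseteq> X" "card S = d x" for S x
    unfolding block_eq using forest[OF finF FI, of S x] that by (simp add: d_def)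
  have host: "host z \<in> V \<and> host z < z" if "z \<in> V - C r" for z
  proof -
    have "top z \<in> I" "top z \<le> z" "top z \<noteq> r" using that top[of z] by (auto simp: C_def)
    then show ?thesis using par[of "top z"] by (auto simp: host_def I_def)
  qed
  have CrV: "C r \<subseteq> V" "C r \<noteq> {}" using CI[OF rI] by (auto simp: C_def)
  obtain g where g: "inj_on g V" "g ` V \<subseteq> X" "\<And>z. z \<in> V - C r \<Longrightarrow> R (g (host z)) (g z)"
    "\<And>u v. u \<in> C r \<Longrightarrow> v \<in> C r \<Longrightarrow> A u v \<Longrightarrow> R (g u) (g v)"
    "\<And>x u v. u \<in> {z \<in> V - C r. host z = x} \<Longrightarrow> v \<in> {z \<in> V - C r. host z = x} \<Longrightarrow> A u v
      \<Longrightarrow> R (g u) (g v)"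
    by (rule tournament_block_embedding
        [OF \<open>finite V\<close> CrV host \<open>finite X\<close> total root_emb block_emb room'];
        (assumption | (rule that; assumption)))
  have "if fwd z then R (g (par z)) (g z) else R (g z) (g (par z))" if z: "z \<in> V - {r}" for z
  proof (cases "fwd z")
    case True
    then have "top z = z" using top_root by blast
    then show ?thesis using g(3)[of z] z True by (simp add: host_def C_def)
  next
    case False
    then have Az: "A z (par z)" and eq: "top (par z) = top z" and pV: "par z \<in> V"
      using z par top_par by (auto simp: A_def)
    have "R (g z) (g (par z))"
    proof (cases "z \<in> C r")
      case True
      then show ?thesis using g(4)[OF _ _ Az] eq pV by (simp add: C_def)
    next
      case False
      then show ?thesis using g(5)[OF _ _ Az, of "host z"] eq pV z by (simp add: C_def host_def)
    qed
    then show ?thesis using False by simp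
  qed
  then show ?thesis using that g(1,2) by blast
qed

text \<open>Reversing all arcs exchanges the two counts of children, so one of the two orientations
  needs at most the average room.\<close>

lemma rooted_tree_embedding_childless:
  fixes V :: "nat set" and r :: nat and par :: "nat \<Rightarrow> nat" and fwd :: "nat \<Rightarrow> bool"
    and R :: "'b \<Rightarrow> 'b \<Rightarrow> bool"
  assumes "finite V" "r \<in> V" and par: "\<And>z. z \<in> V - {r} \<Longrightarrow> par z \<in> V \<and> par z < z"
    and "finite X" and total: "\<And>a b. a \<in> X \<Longrightarrow> b \<in> X \<Longrightarrow> a \<noteq> b \<Longrightarrow> R a b \<or> R b a"
    and room: "3 * (card V + card (V - par ` (V - {r}))) \<le> 2 * card X + 4"
  obtains g where "inj_on g V" "g ` V \<subseteq> X"
    "\<And>z. z \<in> V - {r} \<Longrightarrow> if fwd z then R (g (par z)) (g z) else R (g z) (g (par z))"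
proof -
  define fc where "fc = (\<lambda>x. card {z \<in> V - {r}. par z = x \<and> fwd z})"
  define bc where "bc = (\<lambda>x. card {z \<in> V - {r}. par z = x \<and> \<not> fwd z})"
  define P where "P = par ` (V - {r})"
  have PV: "P \<subseteq> V" using par by (auto simp: P_def)
  have finP: "finite P" using PV \<open>finite V\<close> finite_subset by blast
  have children: "fc x + bc x = card {z \<in> V - {r}. par z = x}" for x
  proof -
    have "{z \<in> V - {r}. par z = x}
        = {z \<in> V - {r}. par z = x \<and> fwd z} \<union> {z \<in> V - {r}. par z = x \<and> \<not> fwd z}" by auto
    moreover have "{z \<in> V - {r}. par z = x \<and> fwd z} \<inter> {z \<in> V - {r}. par z = x \<and> \<not> fwd z} = {}"
      by auto
    ultimately show ?thesis unfolding fc_def bc_def using \<open>finite V\<close> by (simp add: card_Un_disjoint)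
  qed
  have "(\<Sum>x\<in>V. card {z \<in> V - {r}. par z = x}) = card (V - {r})"
    using sum.group[of "V - {r}" V par "\<lambda>_. 1::nat"] \<open>finite V\<close> PV by (simp add: P_def)
  then have sum_children: "(\<Sum>x\<in>V. fc x + bc x) + 1 = card V"
    using children \<open>finite V\<close> \<open>r \<in> V\<close> card_gt_0_iff[of V] by auto
  \<comment> \<open>A node with a child falls short of \<open>2 * (fc x + bc x)\<close> by at least
    1, whichever count is positive. Summed over \<open>V\<close>, with \<open>card V - 1\<close>
    children and \<open>card P\<close> parents, this gives \<open>le\<close>.\<close>
  have "(2 * fc x - 1) + (2 * bc x - 1) + (if x \<in> P then 1 else 0) \<le> 2 * (fc x + bc x)" for x
  proof (cases "x \<in> P")
    case True
    then have "{z \<in> V - {r}. par z = x} \<noteq> {}" by (auto simp: P_def)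
    then have "fc x + bc x > 0" using children \<open>finite V\<close> by (simp add: card_gt_0_iff)
    then show ?thesis by auto
  next
    case False
    then show ?thesis by simp
  qed
  then have "(\<Sum>x\<in>V. (2 * fc x - 1) + (2 * bc x - 1) + (if x \<in> P then 1 else 0))
      \<le> (\<Sum>x\<in>V. 2 * (fc x + bc x))" by (intro sum_mono)
  moreover have "(\<Sum>x\<in>V. if x \<in> P then 1 else (0::nat)) = card P"
    using \<open>finite V\<close> PV by (simp add: sum.If_cases Int_absorb1)
  ultimately have "(\<Sum>x\<in>V. (2 * fc x - 1) + (2 * bc x - 1)) + card P \<le> 2 * (\<Sum>x\<in>V. fc x + bc x)"
    by (simp add: sum.distrib sum_distrib_left)
  moreover have "card (V - P) + card P = card V"
    using PV \<open>finite V\<close> finP by (metis card_Diff_subset card_mono le_add_diff_inverse2)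
  ultimately have le: "(\<Sum>x\<in>V. 2 * fc x - 1) + (\<Sum>x\<in>V. 2 * bc x - 1) + 2 \<le> card V + card (V - P)"
    using sum_children by (simp add: sum.distrib)
  show ?thesis
  proof (cases "1 + (\<Sum>x\<in>V. (2 * fc x - 1) + 2 * (2 * bc x - 1)) \<le> card X")
    case True
    show ?thesis
      by (rule rooted_tree_embedding[OF assms(1-5) True[unfolded fc_def bc_def]];
          (assumption | (rule that; assumption)))
  next
    case False
    define s t where "s = (\<Sum>x\<in>V. 2 * fc x - 1)" and "t = (\<Sum>x\<in>V. 2 * bc x - 1)"
    \<comment> \<open>The two rooms add up to \<open>2 + 3 * (s + t)\<close>, which
      \<open>le\<close> and \<open>room\<close> bound by \<open>2 * card X\<close>; if one exceeds
      \<open>card X\<close>, the other fits.\<close>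
    have "card X < 1 + s + 2 * t"
      using False by (simp add: sum.distrib sum_distrib_left[symmetric] s_def t_def not_le)
    then have "1 + t + 2 * s \<le> card X" using le room unfolding P_def s_def[symmetric] t_def[symmetric]
      by simp
    then have "1 + (\<Sum>x\<in>V. (2 * bc x - 1) + 2 * (2 * fc x - 1)) \<le> card X"
      by (simp add: sum.distrib sum_distrib_left[symmetric] s_def t_def)
    then have room': "1 + (\<Sum>x\<in>V. (2 * card {z \<in> V - {r}. par z = x \<and> \<not> fwd z} - 1)
        + 2 * (2 * card {z \<in> V - {r}. par z = x \<and> \<not> \<not> fwd z} - 1)) \<le> card X"
      by (simp add: fc_def bc_def)
    obtain g where g: "inj_on g V" "g ` V \<subseteq> X"
      "\<And>z. z \<in> V - {r} \<Longrightarrow> if \<not> fwd z then R (g z) (g (par z)) else R (g (par z)) (g z)"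
    proof (rule rooted_tree_embedding[of V r par X "\<lambda>u v. R v u" "\<lambda>z. \<not> fwd z"])
      show "R b a \<or> R a b" if "a \<in> X" "b \<in> X" "a \<noteq> b" for a b using total that by blast
    qed (use assms(1-4) room' in blast)+
    show ?thesis by (rule that[OF g(1,2)]) (use g(3) in auto)
  qed
qed

subsection \<open>Numbering the vertices of a tree\<close>

context pair_graph
begin

lemma awalk_leaves_set:
  assumes "awalk a p b" "a \<in> S" "b \<notin> S"
  obtains u v where "(u, v) \<in> parcs G" "u \<in> S" "v \<notin> S"
proof -
  have "\<exists>u v. (u, v) \<in> parcs G \<and> u \<in> S \<and> v \<notin> S"
    using assms
  proof (induction p arbitrary: a)
    case Nil
    then show ?case by (simp add: awalk_simps)
  next
    case (Cons e p)
    then have e: "e \<in> parcs G" "fst e = a" "awalk (snd e) p b" by (auto simp: awalk_simps)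
    show ?case
    proof (cases "snd e \<in> S")
      case True
      then show ?thesis using Cons e by blast
    next
      case False
      then show ?thesis using Cons e by (metis prod.collapse)
    qed
  qed
  then show ?thesis using that by blast
qed

text \<open>The path from \<open>u\<close> to \<open>b\<close> closes up through \<open>v\<close>.
  As \<open>u \<noteq> b\<close>, it has at least one arc, so the cycle has at least 3 and is not an
  edge traversed back and forth.\<close>

lemma cycle_through_new_vertex:
  assumes p: "apath u p b" and "v \<notin> set (awalk_verts u p)" and "u \<noteq> b"
    and "(u, v) \<in> parcs G" "(b, v) \<in> parcs G"
  shows "\<exists>p. cycle p \<and> 3 \<le> length p"
proof (intro exI conjI)
  have walk: "awalk u p b" and dist: "distinct (awalk_verts u p)" using p by (auto simp: apath_def)
  have "p \<noteq> []" using walk \<open>u \<noteq> b\<close> by (auto simp: awalk_simps)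
  then show "3 \<le> length ((v, u) # p @ [(b, v)])" by (cases p) auto
  have "b \<in> pverts G" "v \<in> pverts G" using assms(5) by (auto dest: wellformed')
  then have last: "awalk b [(b, v)] v" using assms(5) by (simp add: awalk_simps)
  have walk': "awalk u (p @ [(b, v)]) v" using walk last by auto
  have "awalk_verts u (p @ [(b, v)]) = awalk_verts u p @ [v]"
    using awalk_verts_append[OF walk'] by simp
  then have "distinct (awalk_verts u (p @ [(b, v)]))" using dist assms(2) by simp
  then show "cycle ((v, u) # p @ [(b, v)])"
    unfolding cycle_def using walk walk' arcs_symmetric[OF assms(4)]
    by (intro exI[of _ v]) (simp add: awalk_Cons_iff)
qed

text \<open>Adjacent vertices are added one at a time. A second neighbour of the new vertex in the
  numbered set would close a cycle, so the neighbour found is the only one and becomes the parent;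
  hence all edges inside the set remain parent edges. Number 0 is the root.\<close>

lemma acyclic_connected_numbering:
  assumes conn: "Digraph_Component.connected (with_proj G)"
    and acyclic: "\<not> (\<exists>p. cycle p \<and> 3 \<le> length p)"
  obtains \<nu> :: "nat \<Rightarrow> 'a" and par :: "nat \<Rightarrow> nat"
  where "card (pverts G) > 0" "bij_betw \<nu> {..<card (pverts G)} (pverts G)"
    "\<And>z. 0 < z \<Longrightarrow> z < card (pverts G) \<Longrightarrow> par z < z"
    "\<And>a b. (a, b) \<in> parcs G \<Longrightarrow> \<exists>z. 0 < z \<and> z < card (pverts G) \<and> {a, b} = {\<nu> z, \<nu> (par z)}"
proof -
  \<comment> \<open>The last conjunct keeps connecting paths inside the numbered set, so that they
    avoid the vertex added next and can be closed up through it.\<close>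
  define num where "num = (\<lambda>k (\<nu> :: nat \<Rightarrow> 'a) (par :: nat \<Rightarrow> nat).
      inj_on \<nu> {..<k} \<and> \<nu> ` {..<k} \<subseteq> pverts G \<and> (\<forall>z. 0 < z \<and> z < k \<longrightarrow> par z < z)
      \<and> (\<forall>a\<in>\<nu> ` {..<k}. \<forall>b\<in>\<nu> ` {..<k}. (a, b) \<in> parcs G \<longrightarrow>
          (\<exists>z. 0 < z \<and> z < k \<and> {a, b} = {\<nu> z, \<nu> (par z)}))
      \<and> (\<forall>a\<in>\<nu> ` {..<k}. \<forall>b\<in>\<nu> ` {..<k}. \<exists>p. apath a p b \<and> set (awalk_verts a p) \<subseteq> \<nu> ` {..<k}))"
  have sc: "strongly_connected (with_proj G)"
    using symmetric_connected_imp_strongly_connected[OF sym_arcs conn] .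
  then obtain r where r: "r \<in> pverts G" by (auto simp: strongly_connected_def)
  have walks: "\<exists>p. awalk a p b" if "a \<in> pverts G" "b \<in> pverts G" for a b
    using sc that by (auto simp: strongly_connected_def reachable_awalk)
  have n0: "card (pverts G) > 0" using r pair_finite_verts by (auto simp: card_gt_0_iff)
  have "\<exists>\<nu> par. num (Suc k) \<nu> par" if "Suc k \<le> card (pverts G)" for k
    using that
  proof (induction k)
    case 0
    have "num (Suc 0) (\<lambda>_. r) (\<lambda>_. 0)"
      using r by (auto simp: num_def lessThan_Suc apath_Nil_iff intro!: exI[of _ "[]"] dest: no_loops')
    then show ?case by blast
  next
    case (Suc k)
    then obtain \<nu> par where num: "num (Suc k) \<nu> par" by auto
    define S where "S = \<nu> ` {..<Suc k}"
    have inj: "inj_on \<nu> {..<Suc k}" and SV: "S \<subseteq> pverts G"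
      and par: "\<And>z. 0 < z \<Longrightarrow> z < Suc k \<Longrightarrow> par z < z"
      and edges: "\<And>a b. a \<in> S \<Longrightarrow> b \<in> S \<Longrightarrow> (a, b) \<in> parcs G \<Longrightarrow>
        \<exists>z. 0 < z \<and> z < Suc k \<and> {a, b} = {\<nu> z, \<nu> (par z)}"
      and paths: "\<And>a b. a \<in> S \<Longrightarrow> b \<in> S \<Longrightarrow> \<exists>p. apath a p b \<and> set (awalk_verts a p) \<subseteq> S"
      using num unfolding num_def S_def by blast+
    have "card S = Suc k" unfolding S_def using card_image[OF inj] by simp
    then have "S \<noteq> pverts G" using Suc.prems by auto
    then obtain w where w: "w \<in> pverts G" "w \<notin> S" using SV by blast
    have "\<nu> 0 \<in> S" by (simp add: S_def)
    then obtain u v where uv: "(u, v) \<in> parcs G" "u \<in> S" "v \<notin> S"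
      using walks[of "\<nu> 0" w] w SV awalk_leaves_set by (metis subsetD)
    obtain j where j: "j < Suc k" "u = \<nu> j" using uv(2) by (auto simp: S_def)
    have vV: "v \<in> pverts G" and vu: "(v, u) \<in> parcs G"
      using uv(1) arcs_symmetric by (auto dest: wellformed')
    have only: "b = u" if b: "b \<in> S" "(b, v) \<in> parcs G" for b
    proof (rule ccontr)
      assume "b \<noteq> u"
      obtain p where "apath u p b" "set (awalk_verts u p) \<subseteq> S" using paths uv(2) b(1) by blast
      then show False
        using cycle_through_new_vertex[of u p b v] acyclic \<open>b \<noteq> u\<close> uv b by blast
    qed
    define \<nu>' where "\<nu>' = \<nu>(Suc k := v)"
    define par' where "par' = par(Suc k := j)"
    have S': "\<nu>' ` {..<Suc (Suc k)} = insert v S"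
      unfolding \<nu>'_def S_def by (subst lessThan_Suc) auto
    have new: "{v, u} = {\<nu>' (Suc k), \<nu>' (par' (Suc k))}" using j by (simp add: \<nu>'_def par'_def)
    have to_v: "\<exists>p. apath a p v \<and> set (awalk_verts a p) \<subseteq> insert v S" if a: "a \<in> S" for a
    proof -
      obtain p where p: "apath u p a" "set (awalk_verts u p) \<subseteq> S" using paths uv(2) a by blast
      have q: "apath v ((v, u) # p) a" "set (awalk_verts v ((v, u) # p)) \<subseteq> insert v S"
        using p vu uv(3) by (auto simp: apath_Cons_iff)
      have "awalk v ((v, u) # p) a" using q(1) by (simp add: apath_def)
      then have "awalk_verts a (rev_path ((v, u) # p)) = rev (awalk_verts v ((v, u) # p))"
        by (rule awalk_verts_rev_path)
      then show ?thesis using q apath_rev_path[of a "(v, u) # p" v] by (metis set_rev)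
    qed
    have from_v: "\<exists>p. apath v p a \<and> set (awalk_verts v p) \<subseteq> insert v S" if a: "a \<in> S" for a
    proof -
      obtain p where p: "apath u p a" "set (awalk_verts u p) \<subseteq> S" using paths uv(2) a by blast
      have "apath v ((v, u) # p) a" "set (awalk_verts v ((v, u) # p)) \<subseteq> insert v S"
        using p vu uv(3) by (auto simp: apath_Cons_iff)
      then show ?thesis by blast
    qed
    have "num (Suc (Suc k)) \<nu>' par'"
      unfolding num_def S'
    proof (intro conjI allI impI ballI)
      have "inj_on \<nu>' {..<Suc k}" using inj by (simp add: \<nu>'_def inj_on_def)
      moreover have "\<nu>' ` {..<Suc k} = S" unfolding S_def \<nu>'_def by auto
      moreover have "\<nu>' (Suc k) = v" by (simp add: \<nu>'_def)
      ultimately show "inj_on \<nu>' {..<Suc (Suc k)}" using uv(3) by (subst lessThan_Suc) auto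
      show "insert v S \<subseteq> pverts G" using SV vV by blast
      show "par' z < z" if "0 < z \<and> z < Suc (Suc k)" for z
        using that par[of z] j by (auto simp: par'_def less_Suc_eq)
    next
      fix a b assume ab: "a \<in> insert v S" "b \<in> insert v S" "(a, b) \<in> parcs G"
      show "\<exists>z. 0 < z \<and> z < Suc (Suc k) \<and> {a, b} = {\<nu>' z, \<nu>' (par' z)}"
      proof (cases "a \<in> S \<and> b \<in> S")
        case True
        then obtain z where z: "0 < z" "z < Suc k" "{a, b} = {\<nu> z, \<nu> (par z)}" using edges ab(3) by blast
        then show ?thesis using par[OF z(1,2)]
          by (intro exI[of _ z]) (simp add: \<nu>'_def par'_def)
      next
        case False
        have "a \<noteq> b" using ab(3) no_loops' by blast
        then have "{a, b} = {v, u}"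
          using False ab only[of a] only[of b] arcs_symmetric[of a b] by auto
        then show ?thesis using new by (intro exI[of _ "Suc k"]) simp
      qed
    next
      fix a b assume "a \<in> insert v S" "b \<in> insert v S"
      moreover have "\<exists>p. apath v p v \<and> set (awalk_verts v p) \<subseteq> insert v S"
        using vV by (intro exI[of _ "[]"]) (simp add: apath_Nil_iff)
      ultimately show "\<exists>p. apath a p b \<and> set (awalk_verts a p) \<subseteq> insert v S"
        using to_v from_v paths by (metis insert_iff subset_insertI2)
    qed
    then show ?case by blast
  qed
  from this[of "card (pverts G) - 1"] n0 obtain \<nu> par where num: "num (card (pverts G)) \<nu> par" by auto
  then have inj: "inj_on \<nu> {..<card (pverts G)}" and sub: "\<nu> ` {..<card (pverts G)} \<subseteq> pverts G"
    by (auto simp: num_def)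
  have img: "\<nu> ` {..<card (pverts G)} = pverts G"
    using card_subset_eq[OF pair_finite_verts sub] card_image[OF inj] by simp
  have ends: "a \<in> pverts G \<and> b \<in> pverts G" if "(a, b) \<in> parcs G" for a b
    using that by (auto dest: wellformed')
  show ?thesis
  proof (rule that[of \<nu> par, OF n0])
    show "bij_betw \<nu> {..<card (pverts G)} (pverts G)" using inj img by (simp add: bij_betw_def)
    show "par z < z" if "0 < z" "z < card (pverts G)" for z
      using num that unfolding num_def by blast
    show "\<exists>z. 0 < z \<and> z < card (pverts G) \<and> {a, b} = {\<nu> z, \<nu> (par z)}" if "(a, b) \<in> parcs G" for a b
      using num that ends[OF that] unfolding num_def img by blast
  qed
qed

end

subsection \<open>Unavoidability\<close>

lemma arcs_underlying_graph:
  assumes "orientation D G"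
  shows "pverts G = pverts D" "(u, v) \<in> parcs G \<longleftrightarrow> (u, v) \<in> parcs D \<or> (v, u) \<in> parcs D"
proof -
  have G: "G = mk_symmetric (with_proj D)" using assms by (simp add: orientation_def)
  show "pverts G = pverts D" by (simp add: G mk_symmetric_def)
  show "(u, v) \<in> parcs G \<longleftrightarrow> (u, v) \<in> parcs D \<or> (v, u) \<in> parcs D"
    unfolding G parcs_mk_symmetric by (auto intro: bexI[of _ "(v, u)"])
qed

lemma tournamentD:
  assumes "tournament T"
  shows "finite (pverts T)" "parcs T \<subseteq> pverts T \<times> pverts T"
    "\<And>a b. a \<in> pverts T \<Longrightarrow> b \<in> pverts T \<Longrightarrow> a \<noteq> b \<Longrightarrow> (a, b) \<in> parcs T \<or> (b, a) \<in> parcs T"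
proof -
  obtain n G where G: "complete_digraph n (with_proj G)" and o: "orientation T G"
    using assms by (auto simp: tournament_def)
  have "finite (pverts G)" "parcs G = {(u,v). (u,v) \<in> (pverts G \<times> pverts G) \<and> u \<noteq> v}"
    using G unfolding complete_digraph_pair_def by blast+
  then show "finite (pverts T)" "parcs T \<subseteq> pverts T \<times> pverts T"
    "\<And>a b. a \<in> pverts T \<Longrightarrow> b \<in> pverts T \<Longrightarrow> a \<noteq> b \<Longrightarrow> (a, b) \<in> parcs T \<or> (b, a) \<in> parcs T"
    using arcs_underlying_graph[OF o] by auto
qed

text \<open>The copy of \<open>D\<close> is its image under \<open>f\<close>. Arcs are mapped as
  pairs, so head and tail of the image are still the projections, as they are in
  \<open>T\<close>.\<close>

lemma contains_subdigraphI:
  assumes D: "parcs D \<subseteq> pverts D \<times> pverts D" and T: "parcs T \<subseteq> pverts T \<times> pverts T"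
    and f: "inj_on f (pverts D)" "f ` pverts D \<subseteq> pverts T"
    and arcs: "\<And>u v. (u, v) \<in> parcs D \<Longrightarrow> (f u, f v) \<in> parcs T"
  shows "contains_subdigraph T D"
  unfolding contains_subdigraph_def
proof (intro exI conjI)
  define hom where "hom = \<lparr>iso_verts = f, iso_arcs = map_prod f f, iso_head = snd, iso_tail = fst\<rparr>"
  have wf: "wf_digraph (with_proj D)" "wf_digraph (with_proj T)"
    using D T by (auto simp: wf_digraph_def)
  have "inj_on (map_prod f f) (parcs D)"
    using map_prod_inj_on[OF f(1) f(1)] D inj_on_subset by blast
  then show "digraph_iso (with_proj D) (app_iso hom (with_proj D))"
    unfolding digraph_iso_def pre_digraph.digraph_isomorphism_def
    using wf f(1) by (intro exI[of _ hom]) (simp add: hom_def)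
  have "wf_digraph (app_iso hom (with_proj D))"
    using D by (auto simp: wf_digraph_def hom_def)
  then show "subgraph (app_iso hom (with_proj D)) (with_proj T)"
    using wf f(2) arcs by (auto simp: subgraph_def compatible_def hom_def)
qed

theorem mainTheorem2:
  fixes D :: "'a pair_pre_digraph" and n k :: nat
  assumes "oriented_tree D"
    and "card (pverts D) = n"
    and "card (leaves D) = k"
  shows "unavoidable TYPE('b) (3 / 2 * real n + 3 / 2 * real k - 2) D"
  unfolding unavoidable_def
proof (intro allI impI)
  fix T :: "'b pair_pre_digraph"
  assume T: "tournament T \<and> int (card (pverts T)) = \<lceil>3 / 2 * real n + 3 / 2 * real k - 2\<rceil>"
  note T' = tournamentD[OF conjunct1[OF T]]
  have "3 / 2 * real n + 3 / 2 * real k - 2 \<le> real (card (pverts T))"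
    using T by (metis le_of_int_ceiling of_int_of_nat_eq)
  then have "3 * real n + 3 * real k \<le> 2 * real (card (pverts T)) + 4" by linarith
  then have "real (3 * (n + k)) \<le> real (2 * card (pverts T) + 4)" by simp
  then have room: "3 * (n + k) \<le> 2 * card (pverts T) + 4" unfolding of_nat_le_iff .
  obtain G where tree: "undirected_tree G" and o: "orientation D G"
    using assms(1) by (auto simp: oriented_tree_def)
  interpret pair_graph G using tree by (simp add: undirected_tree_def)
  have VG: "pverts G = pverts D" and arcsG: "\<And>u v. (u, v) \<in> parcs G \<longleftrightarrow> (u, v) \<in> parcs D \<or> (v, u) \<in> parcs D"
    using arcs_underlying_graph[OF o] by auto
  have asymD: "(v, u) \<notin> parcs D" if "(u, v) \<in> parcs D" for u v
    using o that by (auto simp: orientation_def dest: asymD)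
  have finD: "finite (pverts D)" using pair_finite_verts VG by simp
  obtain \<nu> par where n: "n > 0" and bij: "bij_betw \<nu> {..<n} (pverts D)"
    and par: "\<And>z. 0 < z \<Longrightarrow> z < n \<Longrightarrow> par z < z"
    and edge: "\<And>a b. (a, b) \<in> parcs G \<Longrightarrow> \<exists>z. 0 < z \<and> z < n \<and> {a, b} = {\<nu> z, \<nu> (par z)}"
    using acyclic_connected_numbering tree assms(2) unfolding undirected_tree_def VG by metis
  have inj: "inj_on \<nu> {..<n}" and img: "\<nu> ` {..<n} = pverts D" using bij by (auto simp: bij_betw_def)
  \<comment> \<open>The only possible neighbour of a childless node is its parent. The inclusion can
    be strict, as a root with a single child is a leaf too; the room bound only calls for an upper
    bound on the childless nodes.\<close>
  have "\<nu> ` ({..<n} - par ` ({..<n} - {0})) \<subseteq> leaves D"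
  proof
    fix x assume "x \<in> \<nu> ` ({..<n} - par ` ({..<n} - {0}))"
    then obtain z where z: "z < n" "z \<notin> par ` ({..<n} - {0})" "x = \<nu> z" by auto
    have "{u. (u, x) \<in> parcs D \<or> (x, u) \<in> parcs D} \<subseteq> {\<nu> (par z)}"
    proof
      fix u assume "u \<in> {u. (u, x) \<in> parcs D \<or> (x, u) \<in> parcs D}"
      then have "(u, x) \<in> parcs G" by (auto simp: arcsG)
      then obtain y where y: "0 < y" "y < n" "{u, x} = {\<nu> y, \<nu> (par y)}" using edge by blast
      have "par y < n" "par y \<noteq> z" using y par[of y] z(2) by auto
      then have "\<nu> (par y) \<noteq> x" using inj z by (auto simp: inj_on_def)
      then have "x = \<nu> y" "u = \<nu> (par y)" using y(3) by (auto simp: doubleton_eq_iff)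
      then show "u \<in> {\<nu> (par z)}" using inj z y by (auto simp: inj_on_def)
    qed
    then have "card {u. (u, x) \<in> parcs D \<or> (x, u) \<in> parcs D} \<le> card {\<nu> (par z)}"
      by (intro card_mono) auto
    then show "x \<in> leaves D" using z img by (auto simp: leaves_def)
  qed
  then have "card (\<nu> ` ({..<n} - par ` ({..<n} - {0}))) \<le> k"
    using assms(3) finD by (metis (no_types, lifting) card_mono finite_subset leaves_def mem_Collect_eq subsetI)
  moreover have "card (\<nu> ` ({..<n} - par ` ({..<n} - {0}))) = card ({..<n} - par ` ({..<n} - {0}))"
    using inj by (intro card_image inj_on_subset[OF inj]) auto
  ultimately have room': "3 * (card {..<n} + card ({..<n} - par ` ({..<n} - {0}))) \<le> 2 * card (pverts T) + 4"
    using room by simp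
  define fwd where "fwd = (\<lambda>z. (\<nu> (par z), \<nu> z) \<in> parcs D)"
  obtain g where g: "inj_on g {..<n}" "g ` {..<n} \<subseteq> pverts T"
    and g_arc: "\<And>z. z \<in> {..<n} - {0} \<Longrightarrow>
      if fwd z then (g (par z), g z) \<in> parcs T else (g z, g (par z)) \<in> parcs T"
  proof (rule rooted_tree_embedding_childless
      [of "{..<n}" 0 par "pverts T" "\<lambda>a b. (a, b) \<in> parcs T" fwd])
    show "par z \<in> {..<n} \<and> par z < z" if "z \<in> {..<n} - {0}" for z using par[of z] that by auto
    show "(a, b) \<in> parcs T \<or> (b, a) \<in> parcs T" if "a \<in> pverts T" "b \<in> pverts T" "a \<noteq> b" for a b
      using T'(3) that by blast
    show "finite (pverts T)" by (rule T'(1))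
    show "0 \<in> {..<n}" using n by simp
    show "3 * (card {..<n} + card ({..<n} - par ` ({..<n} - {0}))) \<le> 2 * card (pverts T) + 4"
      by (rule room')
  qed ((rule finite_lessThan) | (rule that; assumption))+
  define f where "f = (\<lambda>x. g (the_inv_into {..<n} \<nu> x))"
  have f\<nu>: "f (\<nu> z) = g z" if "z < n" for z using that by (simp add: f_def the_inv_into_f_f[OF inj])
  show "contains_subdigraph T D"
  proof (rule contains_subdigraphI)
    show "parcs D \<subseteq> pverts D \<times> pverts D" using arcsG VG by (auto dest: wellformed')
    show "parcs T \<subseteq> pverts T \<times> pverts T" by (rule T'(2))
    show "inj_on f (pverts D)"
      unfolding img[symmetric] using g(1) by (auto simp: inj_on_def f\<nu>)
    show "f ` pverts D \<subseteq> pverts T" unfolding img[symmetric] using g(2) by (auto simp: f\<nu>)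
  next
    fix u v assume uv: "(u, v) \<in> parcs D"
    then obtain z where z: "0 < z" "z < n" "{u, v} = {\<nu> z, \<nu> (par z)}" using edge arcsG by blast
    then have pz: "par z < n" using par[of z] by simp
    from z(3) consider "u = \<nu> (par z)" "v = \<nu> z" | "u = \<nu> z" "v = \<nu> (par z)"
      by (auto simp: doubleton_eq_iff)
    then show "(f u, f v) \<in> parcs T"
    proof cases
      case 1
      then show ?thesis using g_arc[of z] z uv pz by (simp add: fwd_def f\<nu>)
    next
      \<comment> \<open>Asymmetry of \<open>D\<close> excludes the opposite arc, so
        \<open>fwd z\<close> is false here and the backward alternative of \<open>g_arc\<close>
        applies.\<close>
      case 2
      then show ?thesis using g_arc[of z] z asymD[OF uv] pz by (simp add: fwd_def f\<nu>)
    qed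
  qed
qed

end
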